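(* Let $\mathbf{U}_{i,j}(t)$, $0\le i<N_x$, $0\le j<N_y$, be a differentiable-in-time solution, with admissible values, of the semi-discrete scheme $$\frac{d \mathbf{U}_{i,j}}{d t} +\frac{1}{\Delta x} \left(\mathbf{F}^x_{i+\frac12,j} - \mathbf{F}^x_{i-\frac12,j}\right) + \frac{1}{\Delta y} \left(\mathbf{F}^y_{i,j+\frac12} - \mathbf{F}^y_{i,j-\frac12}\right) = \mathcal{S}(\mathbf{U}_{i,j})$$ for the two-fluid relativistic plasma flow equations, where the Maxwell components of the numerical fluxes are the multidimensional-Riemann-solver fluxes $\mathbf{F}^x_m,\mathbf{F}^y_m$ with the second-order MinMod reconstruction (all as defined in the context). Then the discrete divergence of the electric field satisfies $$\frac{d}{d t} \left(\nabla \cdot \mathbf{E}\right)_{i+\frac12,j+\frac12} = -\left(\nabla\cdot\mathbf{J}\right)_{i+\frac12,j+\frac12}$$ for every vertex $(x_{i+\frac12},y_{j+\frac12})$ with $0\le i\le N_x-2$, $0\le j\le N_y-2$, where $\mathbf{J}_{i,j}$ is the current density evaluated at $\mathbf{U}_{i,j}$ (which is consistent with the continuous identity $\partial_t(\nabla\cdot\mathbf{E})=-\nabla\cdot\mathbf{J}$).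
   Context: **Unknowns.** Two fluid species $\alpha\in\{i,e\}$ (ions, electrons) with primitive variables: density $\rho_\alpha>0$, pressure $p_\alpha>0$, velocity $\mathbf{u}_\alpha=(u^x_\alpha,u^y_\alpha,u^z_\alpha)$, $|\mathbf{u}_\alpha|<1$. Constants: $\gamma_\alpha\in(1,2]$ and charge-to-mass ratios $r_\alpha\in\mathbb{R}$. Put $\Gamma_\alpha=(1-|\mathbf{u}_\alpha|^2)^{-1/2}$, $h_\alpha=1+\frac{\gamma_\alpha}{\gamma_\alpha-1}\frac{p_\alpha}{\rho_\alpha}$, $D_\alpha=\rho_\alpha\Gamma_\alpha$, $\mathbf{m}_\alpha=(m_\alpha^x,m_\alpha^y,m_\alpha^z)=\rho_\alpha h_\alpha\Gamma_\alpha^2\mathbf{u}_\alpha$, $\mathcal{E}_\alpha=\rho_\alpha h_\alpha\Gamma_\alpha^2-p_\alpha$ (total energy density). The conservative vector is $\mathbf{U}=(\mathbf{U}_i,\mathbf{U}_e,\mathbf{U}_m)\in\mathbb{R}^{16}$, $\mathbf{U}_\alpha=(D_\alpha,\mathbf{m}_\alpha,\mathcal{E}_\alpha)$, $\mathbf{U}_m=(\mathbf{B},\mathbf{E})=(B_x,B_y,B_z,E_x,E_y,E_z)$. A state is admissible if its fluid parts come from primitive variables satisfying the inequalities above. The current density is $\mathbf{J}=(J_x,J_y,J_z)=\sum_{\alpha}r_\alpha\rho_\alpha\Gamma_\alpha\mathbf{u}_\alpha$. **Source.** $\mathcal{S}=(\mathcal{S}_i,\mathcal{S}_e,\mathcal{S}_m)$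 with $\mathcal{S}_\alpha=\big(0,\ r_\alpha D_\alpha(\mathbf{E}+\mathbf{u}_\alpha\times\mathbf{B}),\ r_\alpha D_\alpha\,\mathbf{u}_\alpha\cdot\mathbf{E}\big)$ and $\mathcal{S}_m=(0,0,0,-J_x,-J_y,-J_z)$. **Mesh.** Uniform rectangular mesh of $[a,b]\times[c,d]$ with cells of size $\Delta x\times\Delta y$, centers $x_i=a+(i+\frac12)\Delta x$, $y_j=c+(j+\frac12)\Delta y$, $0\le i<N_x$, $0\le j<N_y$; vertices $(x_{i+\frac12},y_{j+\frac12})$, $x_{i+\frac12}=\frac{x_i+x_{i+1}}2$, $y_{j+\frac12}=\frac{y_j+y_{j+1}}2$. (The species label $i$ and the cell index $i$ are unrelated.) The scheme is imposed in every cell of the grid; values in cells outside the grid (ghost cells) needed by the stencils are prescribed by the boundary conditions and may be arbitrary. **Fluxes.** $\mathbf{F}^d=(\mathbf{F}^d_i,\mathbf{F}^d_e,\mathbf{F}^d_m)$, $d\in\{x,y\}$. The fluid fluxes $\mathbf{F}^d_\alpha$ are any numerical fluxes consistent with $\mathbf{f}_\alpha^x=(D_\alpha u_\alpha^x, m_\alpha^xu_\alpha^x+p_\alpha, m_\alpha^yu_\alpha^x,m_\alpha^zu_\alpha^x,m_\alpha^x)$ and $\mathbf{f}_\alpha^y=(D_\alpha u_\alpha^y, m_\alpha^xu_\alpha^y, m_\alpha^yu_\alpha^y+p_\alpha,m_\alpha^zu_\alpha^y,m_\alpha^y)$. The Maxwell fluxes are $$\mathbf{F}_{m,i+\frac12,j}^x=\Big(0,\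 -\tfrac12(\tilde E_{z,i+\frac12,j+\frac12}+\tilde E_{z,i+\frac12,j-\frac12}),\ \tilde F^{x,3}_{m,i+\frac12,j},\ 0,\ \tfrac12(\tilde B_{z,i+\frac12,j+\frac12}+\tilde B_{z,i+\frac12,j-\frac12}),\ \tilde F^{x,6}_{m,i+\frac12,j}\Big),$$ $$\mathbf{F}_{m,i,j+\frac12}^y=\Big(\tfrac12(\tilde E_{z,i+\frac12,j+\frac12}+\tilde E_{z,i-\frac12,j+\frac12}),\ 0,\ \tilde F^{y,3}_{m,i,j+\frac12},\ -\tfrac12(\tilde B_{z,i+\frac12,j+\frac12}+\tilde B_{z,i-\frac12,j+\frac12}),\ 0,\ \tilde F^{y,6}_{m,i,j+\frac12}\Big).$$ **MinMod** (componentwise): $\mathrm{MinMod}(a,b,c)=\mathrm{sign}(b-a)\min\{|c-b|,|b-a|\}$ if $\mathrm{sign}(b-a)=\mathrm{sign}(c-b)$, and $0$ otherwise. **Vertex values.** At vertex $(i+\frac12,j+\frac12)$, dropping the subscript $m$ on $\mathbf{U}_m$, the diagonal reconstructions are $\hat{\mathbf{U}}^{SW}=\mathbf{U}_{i,j}+\frac12\mathrm{MinMod}(\mathbf{U}_{i-1,j-1},\mathbf{U}_{i,j},\mathbf{U}_{i+1,j+1})$, $\hat{\mathbf{U}}^{SE}=\mathbf{U}_{i+1,j}+\frac12\mathrm{MinMod}(\mathbf{U}_{i+2,j-1},\mathbf{U}_{i+1,j},\mathbf{U}_{i,j+1})$, $\hat{\mathbf{U}}^{NE}=\mathbf{U}_{i+1,j+1}+\frac12\mathrm{MinMod}(\mathbf{U}_{i+2,j+2},\mathbf{U}_{i+1,j+1},\mathbf{U}_{i,j})$,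 $\hat{\mathbf{U}}^{NW}=\mathbf{U}_{i,j+1}+\frac12\mathrm{MinMod}(\mathbf{U}_{i-1,j+2},\mathbf{U}_{i,j+1},\mathbf{U}_{i+1,j})$, and, with all hatted quantities taken at $(i+\frac12,j+\frac12)$, $$\tilde E_{z,i+\frac12,j+\frac12}=\tfrac14(\hat E_z^{SW}+\hat E_z^{SE}+\hat E_z^{NE}+\hat E_z^{NW})+\tfrac14(\hat B_y^{SE}+\hat B_y^{NE}-\hat B_y^{SW}-\hat B_y^{NW})-\tfrac14(\hat B_x^{NW}+\hat B_x^{NE}-\hat B_x^{SW}-\hat B_x^{SE}),$$ $$\tilde B_{z,i+\frac12,j+\frac12}=\tfrac14(\hat B_z^{SW}+\hat B_z^{SE}+\hat B_z^{NE}+\hat B_z^{NW})-\tfrac14(\hat E_x^{NW}+\hat E_x^{NE}-\hat E_x^{SW}-\hat E_x^{SE})+\tfrac14(\hat E_y^{SE}+\hat E_y^{NE}-\hat E_y^{SW}-\hat E_y^{NW}).$$ **One-dimensional components.** With $\mathbf{U}^-_{i+\frac12,j}=\mathbf{U}_{i,j}+\frac12\mathrm{MinMod}(\mathbf{U}_{i-1,j},\mathbf{U}_{i,j},\mathbf{U}_{i+1,j})$ and $\mathbf{U}^+_{i+\frac12,j}=\mathbf{U}_{i+1,j}-\frac12\mathrm{MinMod}(\mathbf{U}_{i,j},\mathbf{U}_{i+1,j},\mathbf{U}_{i+2,j})$ (for $\mathbf{U}_m$), set $\tilde F^{x,3}_m=\frac12(E_y^-+E_y^+)-\frac12(B_z^+-B_z^-)$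 and $\tilde F^{x,6}_m=-\frac12(B_y^-+B_y^+)-\frac12(E_z^+-E_z^-)$ at $(i+\frac12,j)$; analogously, with traces $\mathbf{U}^\pm_{i,j+\frac12}$ reconstructed in the $y$-direction, $\tilde F^{y,3}_m=-\frac12(E_x^-+E_x^+)-\frac12(B_z^+-B_z^-)$ and $\tilde F^{y,6}_m=\frac12(B_x^-+B_x^+)-\frac12(E_z^+-E_z^-)$ at $(i,j+\frac12)$. **Discrete divergence** of a grid vector function $\mathbf{A}=(A_x,A_y,A_z)$ at a vertex: $$(\nabla\cdot\mathbf{A})_{i+\frac12,j+\frac12}=\frac12\left(\frac{A_{x,i+1,j+1}-A_{x,i,j+1}}{\Delta x}+\frac{A_{x,i+1,j}-A_{x,i,j}}{\Delta x}\right)+\frac12\left(\frac{A_{y,i+1,j+1}-A_{y,i+1,j}}{\Delta y}+\frac{A_{y,i,j+1}-A_{y,i,j}}{\Delta y}\right).$$ *)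

theory Defs
  imports "HOL-Analysis.Analysis"
begin

text \<open>
  The state vector \<open>U = (U_i, U_e, U_m)\<close> in \<open>\<real>\<^sup>1\<^sup>6\<close> is grouped as a nested product:
  a fluid block is \<open>(D, m, \<E>)\<close>, the Maxwell block is \<open>(B, E)\<close>. Spatial components
  \<open>x, y, z\<close> are the components 1, 2, 3 of \<open>real^3\<close>.
\<close>

datatype species = Ion | Electron

type_synonym fluid = "real \<times> (real^3) \<times> real"
type_synonym em = "(real^3) \<times> (real^3)"
type_synonym state = "fluid \<times> fluid \<times> em"
type_synonym 'a grid = "int \<Rightarrow> int \<Rightarrow> 'a"

fun fluid_part :: "species \<Rightarrow> state \<Rightarrow> fluid" where
  "fluid_part Ion (Ui, Ue, Um) = Ui"
| "fluid_part Electron (Ui, Ue, Um) = Ue"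

definition em_part :: "state \<Rightarrow> em" where
  "em_part U = snd (snd U)"

abbreviation mag :: "em \<Rightarrow> real^3" where "mag V \<equiv> fst V"
abbreviation elec :: "em \<Rightarrow> real^3" where "elec V \<equiv> snd V"


subsection \<open>Primitive and conservative variables\<close>

record prim =
  dens :: real
  vel :: "real^3"
  pres :: real

definition prim_admissible :: "prim \<Rightarrow> bool" where
  "prim_admissible W \<longleftrightarrow> dens W > 0 \<and> pres W > 0 \<and> norm (vel W) < 1"

definition lorentz :: "prim \<Rightarrow> real" where
  "lorentz W = 1 / sqrt (1 - (norm (vel W))\<^sup>2)"

definition enthalpy :: "real \<Rightarrow> prim \<Rightarrow> real" where
  "enthalpy \<gamma> W = 1 + \<gamma> / (\<gamma> - 1) * (pres W / dens W)"

definition conservative :: "real \<Rightarrow> prim \<Rightarrow> fluid" where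
  "conservative \<gamma> W =
    (dens W * lorentz W,
     (dens W * enthalpy \<gamma> W * (lorentz W)\<^sup>2) *\<^sub>R vel W,
     dens W * enthalpy \<gamma> W * (lorentz W)\<^sup>2 - pres W)"

definition fluid_admissible :: "real \<Rightarrow> fluid \<Rightarrow> bool" where
  "fluid_admissible \<gamma> V \<longleftrightarrow> (\<exists>W. prim_admissible W \<and> conservative \<gamma> W = V)"

definition admissible :: "(species \<Rightarrow> real) \<Rightarrow> state \<Rightarrow> bool" where
  "admissible \<gamma> U \<longleftrightarrow> (\<forall>\<alpha>. fluid_admissible (\<gamma> \<alpha>) (fluid_part \<alpha> U))"

text \<open>
  The flux and the source are functions of the conservative variables through the primitive
  variables they come from. These are unique for \<open>\<gamma> \<in> (1, 2]\<close>; see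
  \<open>primitive_conservative\<close> below.
\<close>

definition primitive :: "real \<Rightarrow> fluid \<Rightarrow> prim" where
  "primitive \<gamma> V = (THE W. prim_admissible W \<and> conservative \<gamma> W = V)"

lemma conservative_inj_aux:
  fixes k D M E p q :: real
  assumes k: "k \<ge> 2" and D: "D \<ge> 0" and M: "M \<ge> 0"
    and wp: "M < E + p" and wq: "M < E + q"
    and ep: "E + p - M\<^sup>2 / (E + p) = D * sqrt (1 - (M / (E + p))\<^sup>2) + k * p"
    and eq: "E + q - M\<^sup>2 / (E + q) = D * sqrt (1 - (M / (E + q))\<^sup>2) + k * q"
  shows "\<not> p < q"
proof
  assume lt: "p < q"
  have pos: "E + p > 0" "E + q > 0" using M wp wq by linarith+
  have "M / (E + q) \<le> M / (E + p)"
    using M lt pos by (intro divide_left_mono) auto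
  hence "(M / (E + q))\<^sup>2 \<le> (M / (E + p))\<^sup>2"
    using M pos by (intro power_mono) auto
  hence s: "D * sqrt (1 - (M / (E + p))\<^sup>2) \<le> D * sqrt (1 - (M / (E + q))\<^sup>2)"
    using D by (intro mult_left_mono) auto
  have "M * M < (E + p) * (E + q)"
    using M wp wq by (intro mult_strict_mono') auto
  hence "M\<^sup>2 / ((E + p) * (E + q)) < 1"
    using pos by (simp add: power2_eq_square)
  hence "(q - p) * (M\<^sup>2 / ((E + p) * (E + q))) < (q - p) * 1"
    using lt by (intro mult_strict_left_mono) auto
  moreover have "M\<^sup>2 / (E + p) - M\<^sup>2 / (E + q) = (q - p) * (M\<^sup>2 / ((E + p) * (E + q)))"
    using pos by (simp add: field_simps)
  ultimately have "M\<^sup>2 / (E + p) - M\<^sup>2 / (E + q) < q - p" by simp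
  moreover have "k * (q - p) \<ge> 2 * (q - p)"
    using k lt by (intro mult_right_mono) auto
  hence "k * q - k * p \<ge> 2 * (q - p)" by (simp add: right_diff_distrib)
  moreover have False
    if "x - y < q - p" "k * q - k * p \<ge> 2 * (q - p)" "E + p - x = u + k * p"
      "E + q - y = v + k * q" "u \<le> v" for x y u v
    using that by argo
  ultimately show False using ep eq s by blast
qed

lemma conservative_facts:
  assumes g: "1 < \<gamma>" "\<gamma> \<le> 2" and W: "prim_admissible W"
    and c: "conservative \<gamma> W = (D, m, E)"
  shows "D > 0" "norm m < E + pres W" "vel W = (1 / (E + pres W)) *\<^sub>R m"
    "dens W = D * sqrt (1 - (norm (vel W))\<^sup>2)"
    "E + pres W - (norm m)\<^sup>2 / (E + pres W)
      = D * sqrt (1 - (norm m / (E + pres W))\<^sup>2) + \<gamma> / (\<gamma> - 1) * pres W"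
proof -
  define v where "v = norm (vel W)"
  define s where "s = sqrt (1 - v\<^sup>2)"
  define k where "k = \<gamma> / (\<gamma> - 1)"
  define w where "w = dens W * enthalpy \<gamma> W * (lorentz W)\<^sup>2"
  have a: "dens W > 0" "pres W > 0" "0 \<le> v" "v < 1"
    using W by (auto simp: prim_admissible_def v_def)
  have v2: "v\<^sup>2 < 1" using a by (simp add: power_less_one_iff)
  have s0: "s > 0" and s2: "s\<^sup>2 = 1 - v\<^sup>2" using v2 by (auto simp: s_def)
  have l: "lorentz W = 1 / s" by (simp add: lorentz_def s_def v_def)
  have k0: "k > 0" using g by (simp add: k_def)
  have DE: "D = dens W / s" "m = w *\<^sub>R vel W" "w = E + pres W"
    using c by (auto simp: conservative_def l w_def)
  have w1: "w * s\<^sup>2 = dens W + k * pres W"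
  proof -
    have "w = (dens W + k * pres W) / s\<^sup>2"
      using a by (simp add: w_def enthalpy_def l k_def[symmetric] power_divide distrib_left)
    thus ?thesis using s0 by simp
  qed
  have w0: "w > 0"
  proof -
    have "w * s\<^sup>2 > 0" using w1 a k0 by (simp add: add_pos_pos)
    thus ?thesis using s0 by (simp add: zero_less_mult_iff)
  qed
  have nm: "norm m = w * v" using DE w0 by (simp add: v_def)
  show "D > 0" using DE a s0 by simp
  show "norm m < E + pres W" unfolding DE(3)[symmetric] nm using a w0 by simp
  show "vel W = (1 / (E + pres W)) *\<^sub>R m" 
    unfolding DE(3)[symmetric] DE(2) using w0 by simp
  show "dens W = D * sqrt (1 - (norm (vel W))\<^sup>2)"
    unfolding v_def[symmetric] s_def[symmetric] DE(1) using s0 by simp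
  have "w - (norm m)\<^sup>2 / w = w * s\<^sup>2"
    unfolding nm s2 using w0 by (simp add: power2_eq_square right_diff_distrib)
  moreover have "norm m / w = v" using w0 nm by simp
  moreover have "D * s = dens W" using DE(1) s0 by simp
  ultimately show "E + pres W - (norm m)\<^sup>2 / (E + pres W)
      = D * sqrt (1 - (norm m / (E + pres W))\<^sup>2) + \<gamma> / (\<gamma> - 1) * pres W"
    unfolding DE(3)[symmetric] k_def[symmetric] using w1 s_def by simp
qed

lemma primitive_conservative:
  assumes g: "1 < \<gamma>" "\<gamma> \<le> 2" and W: "prim_admissible W"
  shows "primitive \<gamma> (conservative \<gamma> W) = W"
  unfolding primitive_def
proof (rule the_equality)
  show "prim_admissible W \<and> conservative \<gamma> W = conservative \<gamma> W" using W by simp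
next
  fix W' assume W': "prim_admissible W' \<and> conservative \<gamma> W' = conservative \<gamma> W"
  obtain D m E where c: "conservative \<gamma> W = (D, m, E)" by (cases "conservative \<gamma> W") auto
  note f = conservative_facts[OF g W c]
  have c': "conservative \<gamma> W' = (D, m, E)" using W' c by simp
  note f' = conservative_facts[OF g conjunct1[OF W'] c']
  have k: "\<gamma> / (\<gamma> - 1) \<ge> 2" using g by (simp add: field_simps)
  have "\<not> pres W < pres W'"
    by (rule conservative_inj_aux[OF k _ _ f(2) f'(2) f(5) f'(5)]) (use f(1) in auto)
  moreover have "\<not> pres W' < pres W"
    by (rule conservative_inj_aux[OF k _ _ f'(2) f(2) f'(5) f(5)]) (use f(1) in auto)
  ultimately have p: "pres W' = pres W" by simp
  hence u: "vel W' = vel W" using f(3) f'(3) by simp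
  hence "dens W' = dens W" using f(4) f'(4) by simp
  with p u show "W' = W" by simp
qed


subsection \<open>Current, source and exact fluid fluxes\<close>

definition current :: "(species \<Rightarrow> real) \<Rightarrow> (species \<Rightarrow> real) \<Rightarrow> state \<Rightarrow> real^3" where
  "current \<gamma> r U =
    (\<Sum>\<alpha>\<in>{Ion, Electron}.
      let W = primitive (\<gamma> \<alpha>) (fluid_part \<alpha> U)
      in (r \<alpha> * dens W * lorentz W) *\<^sub>R vel W)"

definition fluid_source ::
  "(species \<Rightarrow> real) \<Rightarrow> (species \<Rightarrow> real) \<Rightarrow> species \<Rightarrow> state \<Rightarrow> fluid" where
  "fluid_source \<gamma> r \<alpha> U =
    (let (D, m, En) = fluid_part \<alpha> U;
         u = vel (primitive (\<gamma> \<alpha>) (fluid_part \<alpha> U));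
         B = mag (em_part U);
         E = elec (em_part U)
     in (0, (r \<alpha> * D) *\<^sub>R (E + cross3 u B), r \<alpha> * D * (u \<bullet> E)))"

definition source :: "(species \<Rightarrow> real) \<Rightarrow> (species \<Rightarrow> real) \<Rightarrow> state \<Rightarrow> state" where
  "source \<gamma> r U =
    (fluid_source \<gamma> r Ion U, fluid_source \<gamma> r Electron U, (0, - current \<gamma> r U))"

definition exact_flux_x :: "real \<Rightarrow> fluid \<Rightarrow> fluid" where
  "exact_flux_x \<gamma> V =
    (let (D, m, En) = V; u = vel (primitive \<gamma> V); p = pres (primitive \<gamma> V)
     in (D * u$1, vector [m$1 * u$1 + p, m$2 * u$1, m$3 * u$1], m$1))"

definition exact_flux_y :: "real \<Rightarrow> fluid \<Rightarrow> fluid" where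
  "exact_flux_y \<gamma> V =
    (let (D, m, En) = V; u = vel (primitive \<gamma> V); p = pres (primitive \<gamma> V)
     in (D * u$2, vector [m$1 * u$2, m$2 * u$2 + p, m$3 * u$2], m$2))"

text \<open>
  A numerical fluid flux assigns to a whole grid function and to cell indices \<open>(i, j)\<close> the
  value at the interface \<open>(i + 1/2, j)\<close> (x-direction) or \<open>(i, j + 1/2)\<close> (y-direction);
  this covers every stencil and every reconstruction. Consistency means that the exact flux
  is returned on constant admissible data.
\<close>

type_synonym numflux = "species \<Rightarrow> state grid \<Rightarrow> fluid grid"

definition consistent ::
  "(species \<Rightarrow> real) \<Rightarrow> (real \<Rightarrow> fluid \<Rightarrow> fluid) \<Rightarrow> numflux \<Rightarrow> bool" where
  "consistent \<gamma> f F \<longleftrightarrow>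
    (\<forall>\<alpha> V i j. admissible \<gamma> V \<longrightarrow> F \<alpha> (\<lambda>_ _. V) i j = f (\<gamma> \<alpha>) (fluid_part \<alpha> V))"


subsection \<open>Maxwell fluxes\<close>

definition minmod :: "real \<Rightarrow> real \<Rightarrow> real \<Rightarrow> real" where
  "minmod a b c =
    (if sgn (b - a) = sgn (c - b) then sgn (b - a) * min \<bar>c - b\<bar> \<bar>b - a\<bar> else 0)"

definition Minmod :: "em \<Rightarrow> em \<Rightarrow> em \<Rightarrow> em" where
  "Minmod a b c =
    ((\<chi> k. minmod (mag a $ k) (mag b $ k) (mag c $ k)),
     (\<chi> k. minmod (elec a $ k) (elec b $ k) (elec c $ k)))"

text \<open>Below, \<open>U\<close> is a grid of Maxwell blocks, and indices \<open>(i, j)\<close> of vertex quantities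
  (\<open>hatSW\<close>, ..., \<open>tildeBz\<close>) stand for the vertex \<open>(i + 1/2, j + 1/2)\<close>.\<close>

definition hatSW :: "em grid \<Rightarrow> em grid" where
  "hatSW U i j = U i j + (1/2) *\<^sub>R Minmod (U (i-1) (j-1)) (U i j) (U (i+1) (j+1))"

definition hatSE :: "em grid \<Rightarrow> em grid" where
  "hatSE U i j = U (i+1) j + (1/2) *\<^sub>R Minmod (U (i+2) (j-1)) (U (i+1) j) (U i (j+1))"

definition hatNE :: "em grid \<Rightarrow> em grid" where
  "hatNE U i j =
    U (i+1) (j+1) + (1/2) *\<^sub>R Minmod (U (i+2) (j+2)) (U (i+1) (j+1)) (U i j)"

definition hatNW :: "em grid \<Rightarrow> em grid" where
  "hatNW U i j = U i (j+1) + (1/2) *\<^sub>R Minmod (U (i-1) (j+2)) (U i (j+1)) (U (i+1) j)"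

definition tildeEz :: "em grid \<Rightarrow> real grid" where
  "tildeEz U i j =
    (let SW = hatSW U i j; SE = hatSE U i j; NE = hatNE U i j; NW = hatNW U i j
     in 1/4 * (elec SW $ 3 + elec SE $ 3 + elec NE $ 3 + elec NW $ 3)
      + 1/4 * (mag SE $ 2 + mag NE $ 2 - mag SW $ 2 - mag NW $ 2)
      - 1/4 * (mag NW $ 1 + mag NE $ 1 - mag SW $ 1 - mag SE $ 1))"

definition tildeBz :: "em grid \<Rightarrow> real grid" where
  "tildeBz U i j =
    (let SW = hatSW U i j; SE = hatSE U i j; NE = hatNE U i j; NW = hatNW U i j
     in 1/4 * (mag SW $ 3 + mag SE $ 3 + mag NE $ 3 + mag NW $ 3)
      - 1/4 * (elec NW $ 1 + elec NE $ 1 - elec SW $ 1 - elec SE $ 1)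
      + 1/4 * (elec SE $ 2 + elec NE $ 2 - elec SW $ 2 - elec NW $ 2))"

text \<open>One-sided traces at \<open>(i + 1/2, j)\<close> and at \<open>(i, j + 1/2)\<close>, respectively.\<close>

definition traceXm :: "em grid \<Rightarrow> em grid" where
  "traceXm U i j = U i j + (1/2) *\<^sub>R Minmod (U (i-1) j) (U i j) (U (i+1) j)"

definition traceXp :: "em grid \<Rightarrow> em grid" where
  "traceXp U i j = U (i+1) j - (1/2) *\<^sub>R Minmod (U i j) (U (i+1) j) (U (i+2) j)"

definition traceYm :: "em grid \<Rightarrow> em grid" where
  "traceYm U i j = U i j + (1/2) *\<^sub>R Minmod (U i (j-1)) (U i j) (U i (j+1))"

definition traceYp :: "em grid \<Rightarrow> em grid" where
  "traceYp U i j = U i (j+1) - (1/2) *\<^sub>R Minmod (U i j) (U i (j+1)) (U i (j+2))"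

definition maxwell_flux_x :: "em grid \<Rightarrow> em grid" where
  "maxwell_flux_x U i j =
    (let M = traceXm U i j; P = traceXp U i j;
         F3 = 1/2 * (elec M $ 2 + elec P $ 2) - 1/2 * (mag P $ 3 - mag M $ 3);
         F6 = - (1/2) * (mag M $ 2 + mag P $ 2) - 1/2 * (elec P $ 3 - elec M $ 3)
     in (vector [0, - (1/2) * (tildeEz U i j + tildeEz U i (j-1)), F3],
         vector [0, 1/2 * (tildeBz U i j + tildeBz U i (j-1)), F6]))"

definition maxwell_flux_y :: "em grid \<Rightarrow> em grid" where
  "maxwell_flux_y U i j =
    (let M = traceYm U i j; P = traceYp U i j;
         F3 = - (1/2) * (elec M $ 1 + elec P $ 1) - 1/2 * (mag P $ 3 - mag M $ 3);
         F6 = 1/2 * (mag M $ 1 + mag P $ 1) - 1/2 * (elec P $ 3 - elec M $ 3)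
     in (vector [1/2 * (tildeEz U i j + tildeEz U (i-1) j), 0, F3],
         vector [- (1/2) * (tildeBz U i j + tildeBz U (i-1) j), 0, F6]))"


subsection \<open>The semi-discrete scheme\<close>

definition flux :: "numflux \<Rightarrow> (em grid \<Rightarrow> em grid) \<Rightarrow> state grid \<Rightarrow> state grid" where
  "flux F G U i j =
    (F Ion U i j, F Electron U i j, G (\<lambda>k l. em_part (U k l)) i j)"

text \<open>
  \<open>U t i j\<close> is the state in cell \<open>(i, j)\<close> at time \<open>t\<close>. The scheme and admissibility are imposed
  in the cells of the grid only; all other indices are ghost cells with arbitrary values.
\<close>

definition scheme_solution ::
  "real \<Rightarrow> real \<Rightarrow> nat \<Rightarrow> nat \<Rightarrow> (species \<Rightarrow> real) \<Rightarrow> (species \<Rightarrow> real) \<Rightarrow> numflux \<Rightarrow> numflux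
    \<Rightarrow> real set \<Rightarrow> (real \<Rightarrow> state grid) \<Rightarrow> bool" where
  "scheme_solution dx dy Nx Ny \<gamma> r Fx Fy T U \<longleftrightarrow>
    (\<forall>t\<in>T. \<forall>i\<in>{0..<int Nx}. \<forall>j\<in>{0..<int Ny}.
      admissible \<gamma> (U t i j) \<and>
      (\<exists>U'. ((\<lambda>s. U s i j) has_vector_derivative U') (at t within T) \<and>
        U' + (1 / dx) *\<^sub>R (flux Fx maxwell_flux_x (U t) i j - flux Fx maxwell_flux_x (U t) (i-1) j)
           + (1 / dy) *\<^sub>R (flux Fy maxwell_flux_y (U t) i j - flux Fy maxwell_flux_y (U t) i (j-1))
        = source \<gamma> r (U t i j)))"

text \<open>The discrete divergence at the vertex \<open>(i + 1/2, j + 1/2)\<close>.\<close>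

definition discrete_div :: "real \<Rightarrow> real \<Rightarrow> (real^3) grid \<Rightarrow> real grid" where
  "discrete_div dx dy A i j =
    1/2 * ((A (i+1) (j+1) $ 1 - A i (j+1) $ 1) / dx + (A (i+1) j $ 1 - A i j $ 1) / dx)
  + 1/2 * ((A (i+1) (j+1) $ 2 - A (i+1) j $ 2) / dy + (A i (j+1) $ 2 - A i j $ 2) / dy)"

end

theory Submission imports Defs begin

text \<open>
  The x-flux of \<open>E\<^sub>y\<close> and the y-flux of \<open>E\<^sub>x\<close> are, up to sign, averages over the two ends of
  a cell edge of the same vertex quantity \<open>tildeBz\<close>, and the x-flux of \<open>E\<^sub>x\<close> and the y-flux of
  \<open>E\<^sub>y\<close> vanish. Therefore the flux difference that drives \<open>(E\<^sub>x, E\<^sub>y)\<close> is a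
  discrete curl of \<open>(0, 0, tildeBz)\<close>. With \<open>\<delta>\<close> for centred differences and \<open>\<mu>\<close> for two-point
  averages, the scheme says
  \<open>dE\<^sub>x/dt = \<mu>\<^sub>x \<delta>\<^sub>y tildeBz / \<Delta>y - J\<^sub>x\<close> and \<open>dE\<^sub>y/dt = - \<mu>\<^sub>y \<delta>\<^sub>x tildeBz / \<Delta>x - J\<^sub>y\<close>,
  and the vertex divergence is \<open>\<mu>\<^sub>y \<delta>\<^sub>x / \<Delta>x\<close> applied to the first component plus
  \<open>\<mu>\<^sub>x \<delta>\<^sub>y / \<Delta>y\<close> applied to the second. All these operators commute, so the divergence
  annihilates the curl (\<open>discrete_div_vertex_curl\<close>) and only \<open>- discrete_div J\<close> survives.
  This cancellation is an identity for every function on the vertices. The four cells around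
  an interior vertex all belong to the grid, so the scheme holds in each of them
  (\<open>elec_rate\<close>).
\<close>

text \<open>
  The curl of \<open>(0, 0, \<psi>)\<close> in cell \<open>(i, j)\<close>; its four corners are the vertices
  \<open>(i \<plusminus> 1/2, j \<plusminus> 1/2)\<close>, at which \<open>\<psi>\<close> has the indices \<open>i\<close>, \<open>i-1\<close> and \<open>j\<close>, \<open>j-1\<close>.
\<close>

definition vertex_curl :: "real \<Rightarrow> real \<Rightarrow> real grid \<Rightarrow> (real^3) grid" where
  "vertex_curl dx dy \<psi> i j =
    vector [((\<psi> i j + \<psi> (i-1) j) / 2 - (\<psi> i (j-1) + \<psi> (i-1) (j-1)) / 2) / dy,
            - ((\<psi> i j + \<psi> i (j-1)) / 2 - (\<psi> (i-1) j + \<psi> (i-1) (j-1)) / 2) / dx,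
            0]"

text \<open>
  The two terms of the divergence are, with opposite signs, the mixed difference
  \<open>\<mu>\<^sub>x \<mu>\<^sub>y \<delta>\<^sub>x \<delta>\<^sub>y \<psi> / (\<Delta>x \<Delta>y)\<close>, taken on the three-by-three block of vertices around
  \<open>(i + 1/2, j + 1/2)\<close>.
\<close>

lemma discrete_div_vertex_curl: "discrete_div dx dy (vertex_curl dx dy \<psi>) i j = 0"
proof -
  \<comment> \<open>With the product of both mesh sizes absorbed into \<open>\<kappa>\<close>, the claim is linear in the values of \<open>\<kappa>\<close>.\<close>
  define \<kappa> where "\<kappa> k l = \<psi> k l / (dx * dy)" for k l
  have x: "vertex_curl dx dy \<psi> k l $ 1 / dx
      = (\<kappa> k l + \<kappa> (k-1) l) / 2 - (\<kappa> k (l-1) + \<kappa> (k-1) (l-1)) / 2" for k l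
    by (simp add: vertex_curl_def \<kappa>_def add_divide_distrib diff_divide_distrib mult.commute)
  have y: "vertex_curl dx dy \<psi> k l $ 2 / dy
      = (\<kappa> (k-1) l + \<kappa> (k-1) (l-1)) / 2 - (\<kappa> k l + \<kappa> k (l-1)) / 2" for k l
    by (simp add: vertex_curl_def \<kappa>_def add_divide_distrib diff_divide_distrib)
  show ?thesis
    unfolding discrete_div_def diff_divide_distrib x y by (simp add: field_simps)
qed

lemma discrete_div_diff:
  "discrete_div dx dy (\<lambda>k l. A k l - B k l) i j
    = discrete_div dx dy A i j - discrete_div dx dy B i j"
  by (simp add: discrete_div_def diff_divide_distrib add_divide_distrib)

lemma has_real_derivative_discrete_div:
  assumes "\<And>k l n. k \<in> {i, i+1} \<Longrightarrow> l \<in> {j, j+1} \<Longrightarrow> n \<in> {1, 2} \<Longrightarrow>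
    ((\<lambda>s. A s k l $ n) has_real_derivative A' k l $ n) (at t within T)"
  shows "((\<lambda>s. discrete_div dx dy (A s) i j)
    has_real_derivative discrete_div dx dy A' i j) (at t within T)"
  unfolding discrete_div_def
  by (intro DERIV_add DERIV_cmult DERIV_cdivide DERIV_diff assms) auto

text \<open>
  For each of \<open>E\<^sub>x\<close> and \<open>E\<^sub>y\<close> only the flux along the other axis is nonzero, and its difference
  across the cell is a component of the curl. For \<open>E\<^sub>z\<close> this fails: its fluxes come from the
  one-dimensional traces.
\<close>

lemma elec_rate:
  fixes i j :: int
  assumes sol: "scheme_solution dx dy Nx Ny \<gamma> r Fx Fy T U"
    and cell: "t \<in> T" "0 \<le> i" "i < int Nx" "0 \<le> j" "j < int Ny"
    and n: "n \<in> {1, 2}"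
  shows "((\<lambda>s. elec (em_part (U s i j)) $ n) has_real_derivative
    (vertex_curl dx dy (tildeBz (\<lambda>k l. em_part (U t k l))) i j - current \<gamma> r (U t i j)) $ n)
    (at t within T)"
proof -
  let ?V = "\<lambda>k l. em_part (U t k l)"
  obtain U' where
    deriv: "((\<lambda>s. U s i j) has_vector_derivative U') (at t within T)" and
    eq: "U' + (1 / dx) *\<^sub>R (flux Fx maxwell_flux_x (U t) i j - flux Fx maxwell_flux_x (U t) (i-1) j)
           + (1 / dy) *\<^sub>R (flux Fy maxwell_flux_y (U t) i j - flux Fy maxwell_flux_y (U t) i (j-1))
        = source \<gamma> r (U t i j)"
    using sol[unfolded scheme_solution_def, rule_format, of t i j] cell by auto
  have "bounded_linear (\<lambda>u::state. elec (em_part u) $ n)"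
    unfolding em_part_def
    by (intro bounded_linear_compose[OF bounded_linear_vec_nth] bounded_linear_snd_comp
        bounded_linear_snd)
  from bounded_linear.has_vector_derivative[OF this deriv]
  have elec_deriv: "((\<lambda>s. elec (em_part (U s i j)) $ n) has_real_derivative elec (em_part U') $ n)
      (at t within T)"
    by (simp add: has_real_derivative_iff_has_vector_derivative)
  have rate: "elec (em_part U')
      + (1 / dx) *\<^sub>R (elec (maxwell_flux_x ?V i j) - elec (maxwell_flux_x ?V (i-1) j))
      + (1 / dy) *\<^sub>R (elec (maxwell_flux_y ?V i j) - elec (maxwell_flux_y ?V i (j-1)))
      = - current \<gamma> r (U t i j)"
    using arg_cong[OF eq, of "\<lambda>u. elec (em_part u)"]
    by (simp add: em_part_def flux_def source_def)
  have "elec (em_part U') $ n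
      + (1 / dx) * (elec (maxwell_flux_x ?V i j) $ n - elec (maxwell_flux_x ?V (i-1) j) $ n)
      + (1 / dy) * (elec (maxwell_flux_y ?V i j) $ n - elec (maxwell_flux_y ?V i (j-1)) $ n)
      = - current \<gamma> r (U t i j) $ n"
    using arg_cong[OF rate, of "\<lambda>v. v $ n"] by simp
  hence "elec (em_part U') $ n
      = (vertex_curl dx dy (tildeBz ?V) i j - current \<gamma> r (U t i j)) $ n"
    using n
    by (auto simp: maxwell_flux_x_def maxwell_flux_y_def vertex_curl_def Let_def
        diff_divide_distrib add_divide_distrib)
  with elec_deriv show ?thesis by simp
qed

theorem theorem3p3:
  fixes a b c d dx dy :: real and Nx Ny :: nat
    and \<gamma> r :: "species \<Rightarrow> real"
    and Fx Fy :: numflux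
    and T :: "real set" and U :: "real \<Rightarrow> state grid"
    and i j :: int and t :: real
  assumes "a < b" and "c < d" and "Nx > 0" and "Ny > 0"
    and "dx = (b - a) / real Nx" and "dy = (d - c) / real Ny"
    and "\<And>\<alpha>. 1 < \<gamma> \<alpha> \<and> \<gamma> \<alpha> \<le> 2"
    and "consistent \<gamma> exact_flux_x Fx" and "consistent \<gamma> exact_flux_y Fy"
    and "is_interval T" and "interior T \<noteq> {}"
    and "scheme_solution dx dy Nx Ny \<gamma> r Fx Fy T U"
    and "0 \<le> i" and "i \<le> int Nx - 2" and "0 \<le> j" and "j \<le> int Ny - 2"
    and "t \<in> T"
  shows "((\<lambda>s. discrete_div dx dy (\<lambda>k l. elec (em_part (U s k l))) i j)
      has_real_derivative
        - discrete_div dx dy (\<lambda>k l. current \<gamma> r (U t k l)) i j) (at t within T)"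
proof -
  let ?curl = "vertex_curl dx dy (tildeBz (\<lambda>k l. em_part (U t k l)))"
  let ?J = "\<lambda>k l. current \<gamma> r (U t k l)"
  have "((\<lambda>s. discrete_div dx dy (\<lambda>k l. elec (em_part (U s k l))) i j)
      has_real_derivative discrete_div dx dy (\<lambda>k l. ?curl k l - ?J k l) i j) (at t within T)"
    by (rule has_real_derivative_discrete_div, rule elec_rate[OF assms(12)]) (use assms in auto)
  moreover have "discrete_div dx dy (\<lambda>k l. ?curl k l - ?J k l) i j = - discrete_div dx dy ?J i j"
    by (simp add: discrete_div_diff discrete_div_vertex_curl)
  ultimately show ?thesis by simp
qed

end
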